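(* Let $N$ be a positive integer and let $A^{(1)},\dots,A^{(N)}$ be the $N\times N$ matrices $A^{(k)}=I+S^{(k)}$, where $S^{(k)}_{kk}=0$, $S^{(k)}_{kj}=2$ for $j\ne k$, and $S^{(k)}_{ij}=0$ for $i\neq k$. If $\hat H^{(N)}:=A^{(1)}A^{(2)}\cdots A^{(N)}$, then $$\rho(\hat H^{(N)})^{1/N}=\rho(\{A^{(1)},\dots,A^{(N)}\}),$$ where the left side uses the spectral radius and the right side is the generalized spectral radius of the collection.
   Context: For a finite set $\mathcal M=\{M_1,\dots,M_n\}$ of square matrices of the same size and $k\ge1$, put $\rho_k(\mathcal M)=\max\{\rho(M_{i_1}\cdots M_{i_k})^{1/k}: M_{i_j}\in\mathcal M\}$, where $\rho$ of a single matrix is its spectral radius; the generalized spectral radius is $\rho(\mathcal M)=\limsup_{k\to\infty}\rho_k(\mathcal M)$. *)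

theory Defs
  imports
    "Jordan_Normal_Form.Spectral_Radius"
    "HOL-Library.Extended_Real"
begin

text \<open>
  Matrices carry their dimension at run time, so they do not form a monoid and the dimension
  \<open>n\<close> has to be supplied for the empty product.
\<close>

definition mat_prod_list :: "nat \<Rightarrow> 'a::semiring_1 mat list \<Rightarrow> 'a mat" where
  "mat_prod_list n Ms = foldr (*) Ms (1\<^sub>m n)"

text \<open>
  The value at \<open>k = 0\<close> is junk (the \<open>0\<close>-th root is \<open>0\<close>); only \<open>k \<ge> 1\<close> is meaningful, and the
  limes superior below does not depend on \<open>k = 0\<close>. Repetitions among the factors are allowed.
  The maximum is over a finite nonempty set whenever \<open>\<M>\<close> is finite and nonempty.
\<close>

definition max_spectral_radius :: "nat \<Rightarrow> complex mat set \<Rightarrow> nat \<Rightarrow> real" where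
  "max_spectral_radius n \<M> k =
     Max {root k (spectral_radius (mat_prod_list n Ms)) | Ms. length Ms = k \<and> set Ms \<subseteq> \<M>}"

text \<open>The limes superior is taken in the extended reals, so that it always exists.\<close>

definition generalized_spectral_radius :: "nat \<Rightarrow> complex mat set \<Rightarrow> ereal" where
  "generalized_spectral_radius n \<M> = limsup (\<lambda>k. ereal (max_spectral_radius n \<M> k))"

text \<open>
  Matrix indices start at \<open>0\<close>: \<open>A_mat N k\<close> for \<open>k < N\<close> is the matrix $A^{(k+1)}$ in
  one-based numbering. The entries are real, but the spectral radius is that of complex matrices.
\<close>

definition S_mat :: "nat \<Rightarrow> nat \<Rightarrow> complex mat" where
  "S_mat N k = mat N N (\<lambda>(i, j). if i = k \<and> j \<noteq> k then 2 else 0)"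

definition A_mat :: "nat \<Rightarrow> nat \<Rightarrow> complex mat" where
  "A_mat N k = 1\<^sub>m N + S_mat N k"

definition H_hat :: "nat \<Rightarrow> complex mat" where
  "H_hat N = mat_prod_list N (map (A_mat N) [0..<N])"

end

theory Submission
  imports Defs
begin

text \<open>
  The matrix \<open>A_mat N k\<close> acts on a vector \<open>x\<close> by adding to \<open>x k\<close> twice the sum of all the other
  coordinates. If \<open>\<sigma>\<close> denotes the sum of all coordinates, then \<open>x k\<close> becomes \<open>2 * \<sigma> - x k\<close>, which,
  for a nonnegative vector, is at least every other coordinate and is the larger the smaller
  \<open>x k\<close> was. So the fastest growth should come from always updating a smallest coordinate. A
  coordinate that has just been updated is a largest one; hence, starting from a constant vector,
  going cyclically through the coordinates always updates a smallest one, and a full cycle is an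
  application of \<open>H_hat N\<close>.

  That the greedy choice is optimal is shown with weak submajorization (for every \<open>m\<close>, compare the
  sums of the \<open>m\<close> largest coordinates). If \<open>x\<close> is below \<open>y\<close> in this preorder, then updating an
  arbitrary coordinate of \<open>x\<close> and a smallest coordinate of \<open>y\<close> keeps the results comparable
  (\<open>weakly_submajorized_bump_min\<close>). Consequently, among all words of length \<open>q * N\<close> applied to a
  constant nonnegative vector, the one belonging to \<open>H_hat N ^\<^sub>m q\<close> yields the largest coordinate
  sum (\<open>sum_foldr_bump_le_sweeps\<close>).

  To pass from growth to spectral radii, let \<open>P\<close> be a product of \<open>k\<close> of the matrices and \<open>v\<close> an
  eigenvector for an eigenvalue of maximal modulus. Dominating \<open>v\<close> by a constant vector and applying
  \<open>P\<close> a multiple \<open>N * q\<close> of times, the optimality of the cyclic word bounds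
  \<open>spectral_radius P ^ (N * q)\<close> by a constant times the size of the entries of
  \<open>H_hat N ^\<^sub>m (k * q)\<close>. These grow at most like \<open>c ^ (k * q)\<close> for every \<open>c\<close> above
  \<open>spectral_radius (H_hat N)\<close>. Letting \<open>q\<close> tend to infinity and \<open>c\<close> decrease to the spectral radius
  gives \<open>spectral_radius P ^ N \<le> spectral_radius (H_hat N) ^ k\<close>
  (\<open>spectral_radius_product_power_le\<close>), that is, the upper bound for the generalized spectral
  radius. The lower bound comes from the powers of \<open>H_hat N\<close> itself.
\<close>

section \<open>The action on vectors\<close>

text \<open>
  Vectors are represented by functions of which only the values below \<open>N\<close> matter. The scalar type is
  left open because the same dynamics is run on complex eigenvectors and on the real vectors that
  dominate them.
\<close>

definition bump :: "nat \<Rightarrow> nat \<Rightarrow> (nat \<Rightarrow> 'a::comm_semiring_1) \<Rightarrow> nat \<Rightarrow> 'a" where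
  "bump N i x = x(i := x i + 2 * (\<Sum>j\<in>{..<N} - {i}. x j))"

lemma A_mat_carrier [simp]: "A_mat N k \<in> carrier_mat N N"
  by (simp add: A_mat_def S_mat_def)

lemma mat_prod_list_carrier [simp]:
  "set Ms \<subseteq> carrier_mat N N \<Longrightarrow> mat_prod_list N Ms \<in> carrier_mat N N"
  by (induction Ms) (auto simp: mat_prod_list_def)

lemma mat_prod_list_A_carrier [simp]:
  "mat_prod_list N (map (A_mat N) ws) \<in> carrier_mat N N"
  by (rule mat_prod_list_carrier) auto

lemma A_mat_mult_vec:
  assumes "k < N"
  shows "A_mat N k *\<^sub>v vec N x = vec N (bump N k x)"
proof (rule eq_vecI)
  fix i assume "i < dim_vec (vec N (bump N k x))"
  then have i: "i < N" by simp
  have "(A_mat N k *\<^sub>v vec N x) $ i = (\<Sum>j<N. A_mat N k $$ (i, j) * x j)"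
    using i by (auto simp: A_mat_def S_mat_def scalar_prod_def atLeast0LessThan intro!: sum.cong)
  also have "\<dots> = (\<Sum>j<N. (if j = i then x j else 0) + (if i = k \<and> j \<noteq> k then 2 * x j else 0))"
    using i by (intro sum.cong) (auto simp: A_mat_def S_mat_def)
  also have "\<dots> = x i + (\<Sum>j<N. if i = k \<and> j \<noteq> k then 2 * x j else 0)"
    using i by (simp add: sum.distrib)
  also have "(\<Sum>j<N. if i = k \<and> j \<noteq> k then 2 * x j else 0)
             = (if i = k then 2 * (\<Sum>j\<in>{..<N} - {k}. x j) else 0)"
    by (auto simp: sum_distrib_left intro!: sum.mono_neutral_cong_right split: if_splits)
  finally show "(A_mat N k *\<^sub>v vec N x) $ i = vec N (bump N k x) $ i"
    using i by (simp add: bump_def)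
qed (simp add: A_mat_def S_mat_def)

lemma mat_prod_list_mult_vec:
  assumes "set ws \<subseteq> {..<N}"
  shows "mat_prod_list N (map (A_mat N) ws) *\<^sub>v vec N x = vec N (foldr (bump N) ws x)"
  using assms
proof (induction ws)
  case Nil
  then show ?case by (simp add: mat_prod_list_def)
next
  case (Cons w ws)
  have "mat_prod_list N (map (A_mat N) (w # ws)) *\<^sub>v vec N x
        = (A_mat N w * mat_prod_list N (map (A_mat N) ws)) *\<^sub>v vec N x"
    by (simp add: mat_prod_list_def)
  also have "\<dots> = A_mat N w *\<^sub>v (mat_prod_list N (map (A_mat N) ws) *\<^sub>v vec N x)"
    by (rule assoc_mult_mat_vec[of _ N N _ N]) auto
  finally show ?case
    using Cons by (simp add: A_mat_mult_vec)
qed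

lemma mat_prod_list_append:
  assumes "set Ms \<subseteq> carrier_mat N N" "set Ls \<subseteq> carrier_mat N N"
  shows "mat_prod_list N (Ms @ Ls) = mat_prod_list N Ms * mat_prod_list N Ls"
  using assms
proof (induction Ms)
  case Nil
  then show ?case
    by (simp add: mat_prod_list_def left_mult_one_mat[OF mat_prod_list_carrier, unfolded mat_prod_list_def])
next
  case (Cons M Ms)
  have "mat_prod_list N ((M # Ms) @ Ls) = M * mat_prod_list N (Ms @ Ls)"
    by (simp add: mat_prod_list_def)
  also have "\<dots> = M * (mat_prod_list N Ms * mat_prod_list N Ls)"
    using Cons by simp
  also have "\<dots> = (M * mat_prod_list N Ms) * mat_prod_list N Ls"
    using Cons.prems by (intro assoc_mult_mat[symmetric, of _ N N _ N _ N]) auto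
  finally show ?case by (simp add: mat_prod_list_def)
qed

lemma mat_prod_list_concat_replicate:
  assumes "set Ms \<subseteq> carrier_mat N N"
  shows "mat_prod_list N (concat (replicate q Ms)) = mat_prod_list N Ms ^\<^sub>m q"
proof (induction q)
  case 0
  have "dim_row (mat_prod_list N Ms) = N"
    using mat_prod_list_carrier[OF assms] by auto
  then show ?case by (simp add: mat_prod_list_def)
next
  case (Suc q)
  have "concat (replicate (Suc q) Ms) = concat (replicate q Ms) @ Ms"
    by (simp flip: replicate_append_same)
  moreover have "set (concat (replicate q Ms)) \<subseteq> carrier_mat N N"
    using assms by auto
  ultimately show ?case
    using assms Suc by (simp add: mat_prod_list_append)
qed

section \<open>The greedy word maximizes growth\<close>

text \<open>
  This is the comparison of the sums of the \<open>m\<close> largest coordinates for every \<open>m \<le> N\<close>; quantifying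
  over index sets of equal size avoids sorting the vectors.
\<close>

definition weakly_submajorized :: "nat \<Rightarrow> (nat \<Rightarrow> real) \<Rightarrow> (nat \<Rightarrow> real) \<Rightarrow> bool" where
  "weakly_submajorized N x y \<longleftrightarrow>
     (\<forall>S\<subseteq>{..<N}. \<exists>T\<subseteq>{..<N}. card T = card S \<and> sum x S \<le> sum y T)"

lemma weakly_submajorizedE:
  assumes "weakly_submajorized N x y" "S \<subseteq> {..<N}"
  obtains T where "T \<subseteq> {..<N}" "card T = card S" "sum x S \<le> sum y T"
  using assms unfolding weakly_submajorized_def by blast

lemma weakly_submajorized_refl: "weakly_submajorized N x x"
  by (auto simp: weakly_submajorized_def)

lemma weakly_submajorized_sum_le:
  assumes "weakly_submajorized N x y"
  shows "sum x {..<N} \<le> sum y {..<N}"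
proof -
  obtain T where "T \<subseteq> {..<N}" "card T = card {..<N}" "sum x {..<N} \<le> sum y T"
    using weakly_submajorizedE[OF assms order_refl] by blast
  moreover from this have "T = {..<N}" by (intro card_subset_eq) auto
  ultimately show ?thesis by simp
qed

lemma bump_nonneg:
  fixes x :: "nat \<Rightarrow> real"
  assumes "\<And>j. j < N \<Longrightarrow> x j \<ge> 0" "j < N"
  shows "bump N i x j \<ge> 0"
  using assms by (auto simp: bump_def intro!: add_nonneg_nonneg sum_nonneg)

lemma foldr_bump_nonneg:
  fixes x :: "nat \<Rightarrow> real"
  assumes "\<And>j. j < N \<Longrightarrow> x j \<ge> 0" "j < N"
  shows "foldr (bump N) ws x j \<ge> 0"
  using assms(2) by (induction ws arbitrary: j) (auto intro: assms(1) bump_nonneg)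

text \<open>
  The new coordinate is the sum of the full coordinate sum and an \<open>(N - 1)\<close>-element partial sum.
  Both can be compared under weak submajorization, whereas the equivalent expression
  \<open>2 * \<sigma> - x i\<close> involves a subtraction and cannot be compared directly.
\<close>

lemma bump_eq_total:
  fixes x :: "nat \<Rightarrow> real"
  assumes "i < N"
  shows "bump N i x i = sum x {..<N} + sum x ({..<N} - {i})"
  using assms sum.remove[of "{..<N}" i x] by (simp add: bump_def)

lemma coordinate_le_bump:
  fixes x :: "nat \<Rightarrow> real"
  assumes "\<And>j. j < N \<Longrightarrow> x j \<ge> 0" "i < N" "j < N"
  shows "x j \<le> bump N i x i"
proof -
  have "x j \<le> sum x {..<N}" using assms by (intro member_le_sum) auto
  moreover have "sum x ({..<N} - {i}) \<ge> 0" using assms by (intro sum_nonneg) auto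
  ultimately show ?thesis using assms by (simp add: bump_eq_total)
qed

text \<open>
  The greedy step. A partial sum of size \<open>m > 0\<close> after the update of \<open>x\<close> is largest when it includes
  the new coordinate, so it is at most the sum of three partial sums of the old \<open>x\<close>, of sizes
  \<open>N\<close>, \<open>N - 1\<close> and \<open>m - 1\<close>. Each of them is dominated by a partial sum of \<open>y\<close> of the same size, and
  since \<open>y k\<close> is minimal, those of sizes \<open>N - 1\<close> and \<open>m - 1\<close> may be taken to avoid \<open>k\<close>. Then they
  add up to a partial sum of size \<open>m\<close> after the update of \<open>y\<close>.
\<close>

lemma weakly_submajorized_bump_min:
  assumes xy: "weakly_submajorized N x y"
    and x: "\<And>j. j < N \<Longrightarrow> x j \<ge> 0"
    and i: "i < N" and k: "k < N" and kmin: "\<And>j. j < N \<Longrightarrow> y k \<le> y j"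
  shows "weakly_submajorized N (bump N i x) (bump N k y)"
  unfolding weakly_submajorized_def
proof (intro allI impI)
  fix S assume S: "S \<subseteq> {..<N}"
  then have fS: "finite S" by (rule finite_subset) simp
  show "\<exists>T\<subseteq>{..<N}. card T = card S \<and> sum (bump N i x) S \<le> sum (bump N k y) T"
  proof (cases "S = {}")
    case False
    \<comment> \<open>The element of \<open>S\<close> that is traded for the new coordinate \<open>i\<close>.\<close>
    define s where "s = (if i \<in> S then i else (SOME s. s \<in> S))"
    define R where "R = S - {s}"
    have s: "s \<in> S" using False by (auto simp: s_def some_in_eq)
    have R: "R \<subseteq> {..<N}" "finite R" "i \<notin> R" "card S = Suc (card R)"
      using S s fS card.remove[of S s] by (auto simp: R_def s_def)
    have "sum (bump N i x) S = bump N i x s + sum (bump N i x) R"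
      using s fS by (simp add: R_def sum.remove)
    also have "sum (bump N i x) R = sum x R"
      using R by (intro sum.cong) (auto simp: bump_def)
    also have "bump N i x s \<le> bump N i x i"
    proof (cases "s = i")
      case False
      have "x s \<le> bump N i x i"
        by (rule coordinate_le_bump) (use x i s S in auto)
      with False show ?thesis by (simp add: bump_def)
    qed simp
    finally have le: "sum (bump N i x) S
        \<le> sum x {..<N} + sum x ({..<N} - {i}) + sum x R"
      using i by (simp add: bump_eq_total)

    have total: "sum x {..<N} \<le> sum y {..<N}"
      by (rule weakly_submajorized_sum_le[OF xy])

    obtain Q where Q: "Q \<subseteq> {..<N}" "card Q = card ({..<N} - {i})" "sum x ({..<N} - {i}) \<le> sum y Q"
      using weakly_submajorizedE[OF xy Diff_subset] by blast
    have "card ({..<N} - Q) = 1"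
      using Q i by (subst card_Diff_subset) (auto intro: finite_subset)
    then obtain q where q: "{..<N} - Q = {q}" by (auto simp: card_1_singleton_iff)
    then have "q < N" "Q = {..<N} - {q}" using Q by auto
    then have "sum y Q \<le> sum y ({..<N} - {k})"
      using kmin[of q] k sum.remove[of "{..<N}" q y] sum.remove[of "{..<N}" k y] by simp
    with Q have all_but_one: "sum x ({..<N} - {i}) \<le> sum y ({..<N} - {k})" by simp

    obtain T0 where T0: "T0 \<subseteq> {..<N}" "card T0 = card R" "sum x R \<le> sum y T0"
      using weakly_submajorizedE[OF xy R(1)] by blast
    \<comment> \<open>If \<open>k\<close> is in \<open>T0\<close>, it can be exchanged for an index outside, as \<open>T0\<close> is not everything.\<close>
    have "\<exists>T\<subseteq>{..<N} - {k}. card T = card R \<and> sum y T0 \<le> sum y T"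
    proof (cases "k \<in> T0")
      case True
      have "card R < N"
        using R S card_mono[of "{..<N}" S] by simp
      with T0(2) have "T0 \<noteq> {..<N}" by (metis card_lessThan less_irrefl)
      with T0(1) obtain r where r: "r < N" "r \<notin> T0" by auto
      have fT0: "finite T0" using T0 by (auto intro: finite_subset)
      have "sum y T0 \<le> sum y (insert r (T0 - {k}))"
        using True r fT0 kmin[of r] sum.remove[of T0 k y] by simp
      moreover have "card (insert r (T0 - {k})) = card R"
        using card_Suc_Diff1[OF fT0 True] r(2) fT0 T0(2) by (simp del: card_Diff_insert card_Diff_singleton)
      ultimately show ?thesis
        using T0(1) r True by (intro exI[of _ "insert r (T0 - {k})"]) auto
    next
      case False
      then show ?thesis using T0(1,2) by (intro exI[of _ T0]) auto
    qed
    then obtain T where T: "T \<subseteq> {..<N} - {k}" "card T = card R" "sum x R \<le> sum y T"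
      using T0(3) order_trans by blast
    have fT: "finite T" "k \<notin> T" using T by (auto intro: finite_subset)
    have "sum (bump N k y) T = sum y T"
      using fT by (intro sum.cong) (auto simp: bump_def)
    then have "sum (bump N k y) (insert k T)
               = sum y {..<N} + sum y ({..<N} - {k}) + sum y T"
      using fT k by (simp add: bump_eq_total)
    then show ?thesis
      using le total all_but_one T fT R k
      by (intro exI[of _ "insert k T"]) auto
  qed auto
qed

text \<open>
  The state in the middle of a cycle that goes through the coordinates downwards and has already
  updated those from \<open>k\<close> on: the order
  \<open>x (k - 1) \<le> \<dots> \<le> x 0 \<le> x (N - 1) \<le> \<dots> \<le> x k\<close>, in which the coordinate to be updated
  next comes first. The direction is downwards because the last factor of \<open>H_hat N\<close> acts first.
\<close>

definition cyclically_sorted :: "nat \<Rightarrow> nat \<Rightarrow> (nat \<Rightarrow> real) \<Rightarrow> bool" where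
  "cyclically_sorted N k x \<longleftrightarrow>
     (\<forall>i j. i \<le> j \<longrightarrow> j < N \<longrightarrow> (j < k \<or> k \<le> i) \<longrightarrow> x j \<le> x i) \<and>
     (\<forall>i j. i < k \<longrightarrow> k \<le> j \<longrightarrow> j < N \<longrightarrow> x i \<le> x j)"

lemma cyclically_sorted_const: "cyclically_sorted N k (\<lambda>_. b)"
  by (simp add: cyclically_sorted_def)

lemma cyclically_sorted_wrap: "cyclically_sorted N 0 x \<Longrightarrow> cyclically_sorted N N x"
  by (simp add: cyclically_sorted_def)

lemma cyclically_sorted_min:
  assumes "cyclically_sorted N (Suc k) x" "k < N" "j < N"
  shows "x k \<le> x j"
  using assms by (cases "j \<le> k") (auto simp: cyclically_sorted_def)

lemma cyclically_sorted_bump: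
  assumes "cyclically_sorted N (Suc k) x" "k < N" "\<And>j. j < N \<Longrightarrow> x j \<ge> 0"
  shows "cyclically_sorted N k (bump N k x)"
proof -
  have "x j \<le> bump N k x k" if "j < N" for j
    using coordinate_le_bump[OF assms(3) assms(2) that] .
  moreover have "bump N k x j = x j" if "j \<noteq> k" for j
    using that by (simp add: bump_def)
  ultimately show ?thesis
    using assms(1,2) unfolding cyclically_sorted_def
    by (smt (verit, ccfv_threshold) Suc_leI le_less_trans less_Suc_eq less_le_trans linorder_not_less nat_less_le)
qed

text \<open>
  One cycle on \<open>y\<close> against an arbitrary word of the same length on \<open>x\<close>. The induction runs
  from \<open>k = N\<close> down to the full cycle \<open>k = 0\<close>.
\<close>

lemma weakly_submajorized_sweep:
  assumes "weakly_submajorized N x y" "cyclically_sorted N N y"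
    and x: "\<And>j. j < N \<Longrightarrow> x j \<ge> 0" and y: "\<And>j. j < N \<Longrightarrow> y j \<ge> 0"
    and "k \<le> N" "length ws = N - k" "set ws \<subseteq> {..<N}"
  shows "weakly_submajorized N (foldr (bump N) ws x) (foldr (bump N) [k..<N] y) \<and>
         cyclically_sorted N k (foldr (bump N) [k..<N] y)"
  using assms(5-)
proof (induction k arbitrary: ws rule: inc_induct)
  case base
  then show ?case using assms by simp
next
  case (step k)
  from step.prems step.hyps obtain w us where ws: "ws = w # us"
    by (cases ws) auto
  let ?x = "foldr (bump N) us x" and ?y = "foldr (bump N) [Suc k..<N] y"
  have IH: "weakly_submajorized N ?x ?y" "cyclically_sorted N (Suc k) ?y"
    using step.IH[of us] step.prems by (auto simp: ws)
  have "weakly_submajorized N (bump N w ?x) (bump N k ?y)"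
    using step IH x by (intro weakly_submajorized_bump_min foldr_bump_nonneg)
      (auto simp: ws intro: cyclically_sorted_min)
  moreover have "cyclically_sorted N k (bump N k ?y)"
    using step.hyps IH y by (intro cyclically_sorted_bump foldr_bump_nonneg) auto
  ultimately show ?case
    using step.hyps by (simp add: ws upt_conv_Cons)
qed

lemma weakly_submajorized_sweeps:
  assumes b: "b \<ge> 0" and "length ws = q * N" "set ws \<subseteq> {..<N}"
  shows "weakly_submajorized N (foldr (bump N) ws (\<lambda>_. b))
           (foldr (bump N) (concat (replicate q [0..<N])) (\<lambda>_. b)) \<and>
         cyclically_sorted N N (foldr (bump N) (concat (replicate q [0..<N])) (\<lambda>_. b))"
  using assms(2-)
proof (induction q arbitrary: ws)
  case 0
  then show ?case
    by (simp add: weakly_submajorized_refl cyclically_sorted_const)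
next
  case (Suc q)
  let ?us = "take N ws" and ?vs = "drop N ws"
  let ?x = "foldr (bump N) ?vs (\<lambda>_. b)"
  let ?y = "foldr (bump N) (concat (replicate q [0..<N])) (\<lambda>_. b)"
  have "set ?us \<subseteq> {..<N}" "set ?vs \<subseteq> {..<N}"
    using Suc.prems set_take_subset[of N ws] set_drop_subset[of N ws] by auto
  then have "weakly_submajorized N (foldr (bump N) ?us ?x) (foldr (bump N) [0..<N] ?y) \<and>
        cyclically_sorted N 0 (foldr (bump N) [0..<N] ?y)"
    using Suc.IH[of ?vs] Suc.prems b by (intro weakly_submajorized_sweep foldr_bump_nonneg) auto
  moreover have "foldr (bump N) ?us ?x = foldr (bump N) ws (\<lambda>_. b)"
    by (metis append_take_drop_id comp_apply foldr_append)
  ultimately show ?case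
    by (auto intro: cyclically_sorted_wrap)
qed

lemma sum_foldr_bump_le_sweeps:
  fixes b :: real
  assumes "b \<ge> 0" "length ws = q * N" "set ws \<subseteq> {..<N}"
  shows "(\<Sum>i<N. foldr (bump N) ws (\<lambda>_. b) i)
         \<le> (\<Sum>i<N. foldr (bump N) (concat (replicate q [0..<N])) (\<lambda>_. b) i)"
  using weakly_submajorized_sum_le weakly_submajorized_sweeps[OF assms] by blast

section \<open>Spectral radius and growth\<close>

text \<open>
  The matrices have nonnegative entries, so the triangle inequality lets a real vector dominate a
  complex one along the whole word.
\<close>

lemma norm_foldr_bump_le:
  fixes v :: "nat \<Rightarrow> complex"
  assumes "\<And>i. i < N \<Longrightarrow> norm (v i) \<le> x i" "i < N"
  shows "norm (foldr (bump N) ws v i) \<le> foldr (bump N) ws x i"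
  using assms(2)
proof (induction ws arbitrary: i)
  case (Cons w ws)
  let ?v = "foldr (bump N) ws v" and ?x = "foldr (bump N) ws x"
  show ?case
  proof (cases "i = w")
    case True
    have "norm (?v w + 2 * (\<Sum>j\<in>{..<N} - {w}. ?v j))
          \<le> norm (?v w) + norm (2 * (\<Sum>j\<in>{..<N} - {w}. ?v j))"
      by (rule norm_triangle_ineq)
    also have "\<dots> = norm (?v w) + 2 * norm (\<Sum>j\<in>{..<N} - {w}. ?v j)"
      by (simp add: norm_mult)
    also have "\<dots> \<le> ?x w + 2 * (\<Sum>j\<in>{..<N} - {w}. ?x j)"
      using Cons True by (intro add_mono mult_left_mono sum_norm_le) auto
    finally show ?thesis using True by (simp add: bump_def[of N w])
  qed (use Cons in \<open>simp add: bump_def[of N w]\<close>)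
qed (use assms in simp)

lemma pow_mat_smult:
  fixes A :: "'a::comm_ring_1 mat"
  assumes "A \<in> carrier_mat n n"
  shows "(c \<cdot>\<^sub>m A) ^\<^sub>m q = c ^ q \<cdot>\<^sub>m (A ^\<^sub>m q)"
proof (induction q)
  case (Suc q)
  have "(c \<cdot>\<^sub>m A) ^\<^sub>m Suc q = (c ^ q \<cdot>\<^sub>m (A ^\<^sub>m q)) * (c \<cdot>\<^sub>m A)"
    using Suc by simp
  also have "\<dots> = c ^ Suc q \<cdot>\<^sub>m (A ^\<^sub>m q * A)"
    using assms pow_carrier_mat[OF assms, of q]
    by (intro eq_matI) (auto simp: mult_smult_assoc_mat[of _ n n _ n] mult_smult_distrib[of _ n n _ n])
  finally show ?case by simp
qed (use assms in \<open>auto intro!: eq_matI\<close>)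

text \<open>
  The powers of a matrix of spectral radius less than one are bounded, by its Jordan normal form;
  this is applied to \<open>A\<close> divided by \<open>c\<close>.
\<close>

lemma pow_mat_norm_le_of_spectral_radius_less:
  assumes A: "A \<in> carrier_mat n n" and n: "n > 0" and c: "c > 0" and "spectral_radius A < c"
  shows "\<exists>C. \<forall>q i j. i < n \<longrightarrow> j < n \<longrightarrow> norm ((A ^\<^sub>m q) $$ (i, j)) \<le> C * c ^ q"
proof -
  let ?a = "complex_of_real (1 / c)"
  let ?B = "?a \<cdot>\<^sub>m A"
  have B: "?B \<in> carrier_mat n n" using A by simp
  obtain \<mu> where \<mu>: "\<mu> \<in> spectrum ?B" "norm \<mu> = spectral_radius ?B"
    using spectral_radius_mem_max(1)[OF B n] by auto
  then obtain v where v: "v \<in> carrier_vec n" "v \<noteq> 0\<^sub>v n" "?B *\<^sub>v v = \<mu> \<cdot>\<^sub>v v"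
    using A by (auto simp: spectrum_def eigenvalue_def eigenvector_def)
  have "A *\<^sub>v v = complex_of_real c \<cdot>\<^sub>v (?B *\<^sub>v v)"
    using A v(1) c by (intro eq_vecI) auto
  then have "A *\<^sub>v v = (c * \<mu>) \<cdot>\<^sub>v v"
    using v by (simp add: smult_smult_assoc)
  then have "c * \<mu> \<in> spectrum A"
    using A v by (auto simp: spectrum_def eigenvalue_def eigenvector_def)
  then have "norm (c * \<mu>) \<le> spectral_radius A"
    using spectral_radius_mem_max(2)[OF A n] by blast
  moreover have "norm (c * \<mu>) = c * norm \<mu>"
    using c by (simp add: norm_mult)
  ultimately have "c * norm \<mu> < c" using assms(4) by linarith
  then have "spectral_radius ?B < 1"
    using c \<mu>(2) by simp
  then obtain C where C: "norm_bound (?B ^\<^sub>m q) C" for q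
    using spectral_radius_jnf_norm_bound_less_1[OF B] char_poly_factorized[OF B] jordan_nf_exists[OF B]
    by blast
  have "norm ((A ^\<^sub>m q) $$ (i, j)) \<le> C * c ^ q" if "i < n" "j < n" for q i j
  proof -
    have "norm ((?B ^\<^sub>m q) $$ (i, j)) \<le> C"
      using C[of q] that carrier_matD[OF pow_carrier_mat[OF B, of q]]
      unfolding norm_bound_def by metis
    then have "norm ((A ^\<^sub>m q) $$ (i, j)) / c ^ q \<le> C"
      using that c carrier_matD[OF A]
      by (simp add: pow_mat_smult[OF A] norm_mult norm_divide norm_power power_divide)
    then show ?thesis using c by (simp add: pos_divide_le_eq)
  qed
  then show ?thesis by blast
qed

lemma le_of_power_le_const_mult_power:
  fixes a b :: real
  assumes "b > 0" "\<And>q. a ^ q \<le> K * b ^ q"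
  shows "a \<le> b"
proof (rule ccontr)
  assume "\<not> a \<le> b"
  then have "a / b > 1" using assms(1) by simp
  then obtain q where "K < (a / b) ^ q" using real_arch_pow by blast
  then have "K * b ^ q < a ^ q" using assms(1) by (simp add: power_divide pos_less_divide_eq)
  with assms(2)[of q] show False by simp
qed

lemma spectral_radius_nonneg:
  assumes "A \<in> carrier_mat n n" "n > 0"
  shows "spectral_radius A \<ge> 0"
  using spectral_radius_mem_max(1)[OF assms] by auto

lemma H_hat_carrier [simp]: "H_hat N \<in> carrier_mat N N"
  by (simp add: H_hat_def)

lemma H_hat_pow: "H_hat N ^\<^sub>m q = mat_prod_list N (map (A_mat N) (concat (replicate q [0..<N])))"
  unfolding H_hat_def by (subst mat_prod_list_concat_replicate[symmetric]) (auto simp: map_concat)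

text \<open>
  The greedy orbit of a constant vector consists of the row sums of the powers of \<open>H_hat N\<close>, up to
  the factor \<open>b\<close>.
\<close>

lemma sum_sweeps_le:
  assumes "b \<ge> 0"
    and C: "\<And>i j. i < N \<Longrightarrow> j < N \<Longrightarrow> norm ((H_hat N ^\<^sub>m q) $$ (i, j)) \<le> D"
  shows "(\<Sum>i<N. foldr (bump N) (concat (replicate q [0..<N])) (\<lambda>_. b) i) \<le> real N * (real N * (D * b))"
proof -
  let ?W = "concat (replicate q [0..<N])"
  have bump_of_real: "foldr (bump N) ws (\<lambda>_. complex_of_real b) i
                      = complex_of_real (foldr (bump N) ws (\<lambda>_. b) i)" for ws i
    by (induction ws arbitrary: i) (auto simp: bump_def)
  have H: "H_hat N ^\<^sub>m q \<in> carrier_mat N N" by simp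
  have "foldr (bump N) ?W (\<lambda>_. b) i \<le> real N * (D * b)" if i: "i < N" for i
  proof -
    have "complex_of_real (foldr (bump N) ?W (\<lambda>_. b) i) = (H_hat N ^\<^sub>m q *\<^sub>v vec N (\<lambda>_. complex_of_real b)) $ i"
      unfolding H_hat_pow using i
      by (subst mat_prod_list_mult_vec) (auto simp: bump_of_real)
    also have "\<dots> = (\<Sum>j<N. (H_hat N ^\<^sub>m q) $$ (i, j) * complex_of_real b)"
      using i carrier_matD[OF H] by (simp add: scalar_prod_def atLeast0LessThan)
    finally have "\<bar>foldr (bump N) ?W (\<lambda>_. b) i\<bar> = norm (\<Sum>j<N. (H_hat N ^\<^sub>m q) $$ (i, j) * complex_of_real b)"
      by (metis norm_of_real)
    also have "\<dots> \<le> (\<Sum>j<N. D * b)"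
      using C i assms(1) by (intro sum_norm_le) (simp add: norm_mult mult_right_mono)
    finally show ?thesis by simp
  qed
  then have "(\<Sum>i<N. foldr (bump N) ?W (\<lambda>_. b) i) \<le> (\<Sum>i<N. real N * (D * b))"
    by (intro sum_mono) auto
  then show ?thesis by simp
qed

text \<open>
  The upper bound, free of roots. The \<open>N\<close>-th power on the left makes the lengths match: the word of
  \<open>P\<close> repeated \<open>N * q\<close> times has the length of \<open>length ws * q\<close> full cycles.
\<close>

lemma spectral_radius_product_power_le:
  assumes N: "N > 0" and ws: "set ws \<subseteq> {..<N}"
  shows "spectral_radius (mat_prod_list N (map (A_mat N) ws)) ^ N
         \<le> spectral_radius (H_hat N) ^ length ws"
proof -
  let ?P = "mat_prod_list N (map (A_mat N) ws)"
  let ?k = "length ws"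
  obtain \<mu> where \<mu>: "\<mu> \<in> spectrum ?P" "norm \<mu> = spectral_radius ?P"
    using spectral_radius_mem_max(1)[OF mat_prod_list_A_carrier N, of ws] by auto
  have dim: "dim_row ?P = N" by (rule carrier_matD(1)[OF mat_prod_list_A_carrier])
  obtain v where ev: "eigenvector ?P v \<mu>"
    using \<mu> by (auto simp: spectrum_def eigenvalue_def)
  then have v: "v \<in> carrier_vec N" "v \<noteq> 0\<^sub>v N"
    by (auto simp: eigenvector_def dim)
  \<comment> \<open>A constant that dominates \<open>v\<close> coordinatewise and is recovered by summing the norms of \<open>v\<close>.\<close>
  define b where "b = (\<Sum>i<N. norm (v $ i))"
  obtain i0 where "i0 < N" "v $ i0 \<noteq> 0"
    using v by (metis carrier_vecD eq_vecI index_zero_vec)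
  then have b: "b > 0"
    unfolding b_def by (intro sum_pos2[of _ i0]) auto

  have growth: "norm \<mu> ^ m * b \<le> (\<Sum>i<N. foldr (bump N) (concat (replicate m ws)) (\<lambda>_. b) i)" for m
  proof -
    let ?W = "concat (replicate m ws)"
    have W: "set ?W \<subseteq> {..<N}" using ws by auto
    have "\<mu> ^ m \<cdot>\<^sub>v v = ?P ^\<^sub>m m *\<^sub>v v"
      using eigenvector_pow[OF mat_prod_list_A_carrier ev] by simp
    also have "?P ^\<^sub>m m = mat_prod_list N (map (A_mat N) ?W)"
      by (subst mat_prod_list_concat_replicate[symmetric]) (auto simp: map_concat)
    also have "v = vec N (\<lambda>i. v $ i)" using v by auto
    also have "mat_prod_list N (map (A_mat N) ?W) *\<^sub>v vec N (\<lambda>i. v $ i) = vec N (foldr (bump N) ?W (\<lambda>i. v $ i))"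
      by (rule mat_prod_list_mult_vec[OF W])
    finally have eq: "\<mu> ^ m \<cdot>\<^sub>v vec N (($) v) = vec N (foldr (bump N) ?W (($) v))" .
    have "norm \<mu> ^ m * norm (v $ i) \<le> foldr (bump N) ?W (\<lambda>_. b) i" if i: "i < N" for i
    proof -
      have "\<mu> ^ m * v $ i = foldr (bump N) ?W (($) v) i"
        using arg_cong[OF eq, of "\<lambda>u. u $ i"] i by simp
      then have "norm \<mu> ^ m * norm (v $ i) = norm (foldr (bump N) ?W (($) v) i)"
        by (metis norm_mult norm_power)
      also have "\<dots> \<le> foldr (bump N) ?W (\<lambda>_. b) i"
        using i by (intro norm_foldr_bump_le) (auto simp: b_def intro: member_le_sum)
      finally show ?thesis .
    qed
    then show ?thesis
      unfolding b_def sum_distrib_left by (intro sum_mono) (auto simp: b_def)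
  qed

  have bound: "norm \<mu> ^ N \<le> c ^ ?k" if c: "spectral_radius (H_hat N) < c" for c
  proof -
    have c0: "c > 0" using c spectral_radius_nonneg[OF H_hat_carrier N] by linarith
    obtain C where C: "\<And>q i j. i < N \<Longrightarrow> j < N \<Longrightarrow> norm ((H_hat N ^\<^sub>m q) $$ (i, j)) \<le> C * c ^ q"
      using pow_mat_norm_le_of_spectral_radius_less[OF H_hat_carrier N c0 c] by blast
    have "(norm \<mu> ^ N) ^ q \<le> (real N * real N * C) * (c ^ ?k) ^ q" for q
    proof -
      have "norm \<mu> ^ (N * q) * b \<le> (\<Sum>i<N. foldr (bump N) (concat (replicate (N * q) ws)) (\<lambda>_. b) i)"
        by (rule growth)
      also have "\<dots> \<le> (\<Sum>i<N. foldr (bump N) (concat (replicate (?k * q) [0..<N])) (\<lambda>_. b) i)"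
        using b ws by (intro sum_foldr_bump_le_sweeps)
          (auto simp: length_concat sum_list_replicate)
      also have "\<dots> \<le> real N * (real N * ((C * c ^ (?k * q)) * b))"
        using b C by (intro sum_sweeps_le) auto
      finally have "norm \<mu> ^ (N * q) * b \<le> (real N * real N * C * c ^ (?k * q)) * b"
        by (simp add: mult_ac)
      then show ?thesis using b by (simp add: power_mult)
    qed
    then show ?thesis
      by (rule le_of_power_le_const_mult_power[rotated]) (simp add: c0)
  qed
  have "((\<lambda>c. c ^ ?k) \<longlongrightarrow> spectral_radius (H_hat N) ^ ?k) (at_right (spectral_radius (H_hat N)))"
    by (intro tendsto_intros)
  moreover have "\<forall>\<^sub>F c in at_right (spectral_radius (H_hat N)). norm \<mu> ^ N \<le> c ^ ?k"
    using eventually_at_right_less by (rule eventually_mono) (rule bound)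
  ultimately have "norm \<mu> ^ N \<le> spectral_radius (H_hat N) ^ ?k"
    by (intro tendsto_lowerbound) auto
  then show ?thesis using \<mu> by simp
qed

lemma spectral_radius_pow_ge:
  assumes A: "A \<in> carrier_mat n n" and n: "n > 0"
  shows "spectral_radius A ^ q \<le> spectral_radius (A ^\<^sub>m q)"
proof -
  obtain \<mu> where \<mu>: "\<mu> \<in> spectrum A" "norm \<mu> = spectral_radius A"
    using spectral_radius_mem_max(1)[OF A n] by auto
  then obtain v where v: "eigenvector A v \<mu>"
    by (auto simp: spectrum_def eigenvalue_def)
  have "eigenvector (A ^\<^sub>m q) v (\<mu> ^ q)"
    using v eigenvector_pow[OF A v, of q] A by (simp add: eigenvector_def)
  then have "\<mu> ^ q \<in> spectrum (A ^\<^sub>m q)"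
    by (auto simp: spectrum_def eigenvalue_def)
  then have "norm (\<mu> ^ q) \<le> spectral_radius (A ^\<^sub>m q)"
    using spectral_radius_mem_max(2)[OF pow_carrier_mat[OF A] n] by blast
  then show ?thesis using \<mu> by (simp add: norm_power)
qed

theorem proposition5p3:
  fixes N :: nat
  assumes "N > 0"
  shows "ereal (root N (spectral_radius (H_hat N))) =
         generalized_spectral_radius N (A_mat N ` {..<N})"
proof (rule antisym)
  let ?\<M> = "A_mat N ` {..<N}"
  let ?roots = "\<lambda>k. {root k (spectral_radius (mat_prod_list N Ms)) | Ms. length Ms = k \<and> set Ms \<subseteq> ?\<M>}"
  let ?\<rho> = "spectral_radius (H_hat N)"
  have \<rho>: "?\<rho> \<ge> 0" by (rule spectral_radius_nonneg[OF H_hat_carrier assms])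
  have roots_image: "?roots k = (\<lambda>Ms. root k (spectral_radius (mat_prod_list N Ms))) `
      {Ms. set Ms \<subseteq> ?\<M> \<and> length Ms = k}" for k
    by auto
  have finite_roots: "finite (?roots k)" for k
    unfolding roots_image by (intro finite_imageI finite_lists_length_eq) simp

  have "max_spectral_radius N ?\<M> k \<le> root N ?\<rho>" if k: "k > 0" for k
    unfolding max_spectral_radius_def
  proof (rule Max.boundedI[OF finite_roots])
    have "replicate k (A_mat N 0) \<in> {Ms. set Ms \<subseteq> ?\<M> \<and> length Ms = k}"
      using assms by auto
    then show "?roots k \<noteq> {}" unfolding roots_image by blast
  next
    fix r assume "r \<in> ?roots k"
    then obtain Ms where Ms: "r = root k (spectral_radius (mat_prod_list N Ms))"
      "length Ms = k" "set Ms \<subseteq> ?\<M>" by auto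
    then have "Ms \<in> lists (A_mat N ` {..<N})" by auto
    then obtain ws where ws: "Ms = map (A_mat N) ws" "set ws \<subseteq> {..<N}"
      unfolding lists_image by auto
    let ?s = "spectral_radius (mat_prod_list N Ms)"
    have s: "?s \<ge> 0"
      unfolding ws by (rule spectral_radius_nonneg[OF mat_prod_list_A_carrier assms])
    have "?s ^ N \<le> ?\<rho> ^ k"
      using spectral_radius_product_power_le[OF assms ws(2)] Ms ws by simp
    then have "root k (root N (?s ^ N)) \<le> root k (root N (?\<rho> ^ k))"
      using assms k by simp
    moreover have "root k (root N (?\<rho> ^ k)) = root N ?\<rho>"
      using \<rho> assms k by (simp add: real_root_power real_root_power_cancel)
    ultimately show "r \<le> root N ?\<rho>"
      using s assms Ms by (simp add: real_root_power_cancel)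
  qed
  then show "generalized_spectral_radius N ?\<M> \<le> ereal (root N ?\<rho>)"
    unfolding generalized_spectral_radius_def
    by (intro Limsup_bounded) (auto intro: eventually_sequentiallyI[of 1])

  \<comment> \<open>\<open>Suc q\<close> rather than \<open>q\<close>, since the value at \<open>k = 0\<close> is meaningless.\<close>
  have sub: "root N ?\<rho> \<le> max_spectral_radius N ?\<M> (N * Suc q)" for q
  proof -
    have "root N ?\<rho> = root (N * Suc q) (?\<rho> ^ Suc q)"
      by (simp only: real_root_mult_exp real_root_power_cancel[OF zero_less_Suc \<rho>])
    also have "\<dots> \<le> root (N * Suc q) (spectral_radius (H_hat N ^\<^sub>m Suc q))"
      by (rule real_root_le_mono[OF _ spectral_radius_pow_ge[OF H_hat_carrier assms]])
        (use assms in simp)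
    also have "\<dots> \<le> max_spectral_radius N ?\<M> (N * Suc q)"
      unfolding max_spectral_radius_def
    proof (rule Max_ge[OF finite_roots])
      let ?Ms = "map (A_mat N) (concat (replicate (Suc q) [0..<N]))"
      have "length ?Ms = N * Suc q" "set ?Ms \<subseteq> ?\<M>"
        by (auto simp: length_concat sum_list_replicate)
      then show "root (N * Suc q) (spectral_radius (H_hat N ^\<^sub>m Suc q)) \<in> ?roots (N * Suc q)"
        unfolding H_hat_pow mem_Collect_eq by (intro exI[of _ ?Ms] conjI refl)
    qed
    finally show ?thesis .
  qed
  let ?f = "\<lambda>k. ereal (max_spectral_radius N ?\<M> k)"
  have mono: "strict_mono (\<lambda>q. N * Suc q)"
    using assms by (intro strict_monoI) simp
  have "ereal (root N ?\<rho>) \<le> limsup (?f \<circ> (\<lambda>q. N * Suc q))"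
    using sub by (intro le_Limsup) (auto simp del: mult_Suc_right)
  also have "\<dots> \<le> limsup ?f"
    by (rule limsup_subseq_mono[OF mono])
  finally show "ereal (root N ?\<rho>) \<le> generalized_spectral_radius N ?\<M>"
    unfolding generalized_spectral_radius_def .
qed

end
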